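(* Let $\Lambda$ be a discrete (locally finite) multiset in $\mathbb C$ partitioned, with multiplicity, into finite nonempty clusters $\Gamma_\alpha$ (so $\Lambda=\sum_\alpha\Gamma_\alpha$). Let $c_\alpha\in\mathbb C$ be centers, let $0\le r_\alpha\le H<\infty$, and let $\Gamma'_\alpha$ be finite multisets such that for every $\alpha$ $$\Gamma_\alpha\cup\Gamma'_\alpha\subset\{z:|z-c_\alpha|\le r_\alpha\},\qquad m_\alpha:=|\Gamma_\alpha|=|\Gamma'_\alpha|,$$ $$\sum_{\lambda\in\Gamma_\alpha}\lambda^p=\sum_{\mu\in\Gamma'_\alpha}\mu^p\qquad(p=1,2).$$ Assume the local cubic-mass bound $$B_3:=\sup_{w\in\mathbb C}\ \sum_{\alpha:\,|c_\alpha-w|<1}m_\alpha r_\alpha^3<\infty .$$ Set $\Lambda'=\sum_\alpha\Gamma'_\alpha$. Then $\Lambda$ is a zero set for $\mathcal F^2$ if and only if $\Lambda'$ is a zero set for $\mathcal F^2$. Uniqueness is preserved as well: $\Lambda$ is a uniqueness multiset if and only if $\Lambda'$ is.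
   Context: $dA$ is planar Lebesgue measure. The Bargmann–Fock space $\mathcal F^2$ is the space of entire functions $f$ with $\frac1\pi\int_{\mathbb C}|f|^2e^{-|z|^2}dA<\infty$. Multisets have locally finite support and finite multiplicities and are identified with their counting measures; $|\Gamma|$ is the total multiplicity of a finite multiset, and sums over multisets are with multiplicity. A multiset is a zero set for $\mathcal F^2$ if it is the exact zero multiset (with multiplicities) of some nonzero $f\in\mathcal F^2$; it is a uniqueness multiset if $0$ is the only element of $\mathcal F^2$ vanishing on it with at least the prescribed multiplicities. *)

theory Defs
  imports "HOL-Complex_Analysis.Complex_Analysis" "HOL-Library.Multiset"
begin

definition fock :: "(complex \<Rightarrow> complex) set" where
  "fock = {f. f holomorphic_on UNIV \<and>
     ennreal (1 / pi) *
       (\<integral>\<^sup>+ z. ennreal ((cmod (f z))\<^sup>2 * exp (- (cmod z)\<^sup>2)) \<partial>lborel) < \<infinity>}"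

text \<open>
  Possibly infinite multisets in the plane are given by their multiplicity functions
  \<^typ>\<open>complex \<Rightarrow> nat\<close>; finite ones (the clusters) are of type \<^typ>\<open>complex multiset\<close>.
\<close>

definition locally_finite_mult :: "(complex \<Rightarrow> nat) \<Rightarrow> bool" where
  "locally_finite_mult L \<longleftrightarrow> (\<forall>K. compact K \<longrightarrow> finite {z \<in> K. L z \<noteq> 0})"

text \<open>
  The sum of a family of finite multisets. It has its intended meaning when every point lies in
  only finitely many members of the family (otherwise the \<open>sum\<close> at that point is \<open>0\<close> by
  convention), so the condition is part of \<open>is_partition\<close>. If the members of two families,
  the first one consisting of nonempty multisets and having a locally finite sum, lie in common
  discs of bounded radii, then the second family inherits the condition from the first.
\<close>

definition cluster_sum :: "'i set \<Rightarrow> ('i \<Rightarrow> complex multiset) \<Rightarrow> complex \<Rightarrow> nat" where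
  "cluster_sum I G z = (\<Sum>\<alpha> | \<alpha> \<in> I \<and> z \<in># G \<alpha>. count (G \<alpha>) z)"

definition is_partition ::
    "(complex \<Rightarrow> nat) \<Rightarrow> 'i set \<Rightarrow> ('i \<Rightarrow> complex multiset) \<Rightarrow> bool" where
  "is_partition L I G \<longleftrightarrow>
     (\<forall>\<alpha>\<in>I. G \<alpha> \<noteq> {#}) \<and>
     (\<forall>z. finite {\<alpha>\<in>I. z \<in># G \<alpha>}) \<and>
     L = cluster_sum I G"

text \<open>
  For an entire function that is not identically zero, \<^const>\<open>zorder\<close> is the order of vanishing
  (\<open>0\<close> where the function does not vanish). It is unspecified for the zero function, which is
  therefore treated separately below.
\<close>

definition zero_mult :: "(complex \<Rightarrow> complex) \<Rightarrow> complex \<Rightarrow> nat" where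
  "zero_mult f z = nat (zorder f z)"

definition vanishes_on :: "(complex \<Rightarrow> complex) \<Rightarrow> (complex \<Rightarrow> nat) \<Rightarrow> bool" where
  "vanishes_on f L \<longleftrightarrow> f = (\<lambda>_. 0) \<or> (\<forall>z. L z \<le> zero_mult f z)"

definition fock_zero_set :: "(complex \<Rightarrow> nat) \<Rightarrow> bool" where
  "fock_zero_set L \<longleftrightarrow> (\<exists>f\<in>fock. f \<noteq> (\<lambda>_. 0) \<and> (\<forall>z. zero_mult f z = L z))"

definition fock_uniqueness_mult :: "(complex \<Rightarrow> nat) \<Rightarrow> bool" where
  "fock_uniqueness_mult L \<longleftrightarrow> (\<forall>f\<in>fock. vanishes_on f L \<longrightarrow> f = (\<lambda>_. 0))"

end

theory Submission
  imports Defs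
begin

text \<open>
  Let \<open>P\<^sub>\<alpha>\<close> and \<open>P\<^sub>\<alpha>'\<close> be the monic polynomials with roots \<open>\<Gamma> \<alpha>\<close> and \<open>\<Gamma>' \<alpha>\<close>. An entire function \<open>f\<close> that
  vanishes on \<open>\<Lambda>\<close> is turned into one that vanishes on \<open>\<Lambda>'\<close> by multiplication with all quotients
  \<open>P\<^sub>\<alpha>' / P\<^sub>\<alpha>\<close>; the orders of vanishing change exactly by \<open>\<Lambda>' - \<Lambda>\<close>. The claim is that the product makes
  sense and maps Fock functions to Fock functions. As the hypotheses are symmetric, both
  equivalences follow.
  
  Away from the cluster, \<open>ln (P\<^sub>\<alpha>' / P\<^sub>\<alpha>)\<close> has an expansion in powers of \<open>1 / (z - c\<^sub>\<alpha>)\<close> whose coefficients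
  are the differences of the power sums. The matching conditions kill the terms of order \<open>0\<close>, \<open>1\<close> and
  \<open>2\<close>, so the logarithm is \<open>O(m\<^sub>\<alpha> r\<^sub>\<alpha>\<^sup>3 / \<bar>z - c\<^sub>\<alpha>\<bar>\<^sup>3)\<close> (\<open>log_quot_bound\<close>). The third power is summable over a
  planar lattice, so the local bound on the masses \<open>m\<^sub>\<alpha> r\<^sub>\<alpha>\<^sup>3\<close> bounds the sum of these terms over all
  clusters at distance at least \<open>1\<close> from \<open>z\<close>, uniformly in \<open>z\<close> (\<open>cubic_potential_bounded\<close>). This settles
  convergence, and it bounds the product over the clusters far from \<open>z\<close> from above.
  
  Near a cluster the quotient has poles, and as the number of points of a cluster is not bounded,
  dividing by the linear factors one at a time gives no estimate. But the function \<open>h\<close>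
  obtained from \<open>f\<close> by exchanging only the clusters near \<open>w\<close> is entire, and on a circle about \<open>w\<close> of a fixed large radius these clusters are far away, so \<open>\<bar>h\<bar> \<le> const * \<bar>f\<bar>\<close>
  there. By the mean value property with a modified exponential weight (\<open>fock_density_circle_mean\<close>),
  the Fock density of the new function at \<open>w\<close> is at most a constant times the mean of the density of
  \<open>f\<close> on that circle. Integration over \<open>w\<close> bounds the new norm by a multiple of the old one
  (\<open>exchange_zeros\<close>).
\<close>

section \<open>The cubic potential of a locally bounded mass\<close>

lemma bounded_sums_int_powr:
  "\<exists>K\<ge>0. \<forall>X :: int set. finite X \<longrightarrow> (\<Sum>j\<in>X. (1 + \<bar>real_of_int j\<bar>) powr (-3/2)) \<le> K"
proof -
  define \<phi> where "\<phi> x = (1 + \<bar>x\<bar>) powr (-3/2)" for x :: real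
  have nn: "\<phi> x \<ge> 0" for x by (simp add: \<phi>_def)
  have "summable (\<lambda>n. real n powr (-3/2))" by (simp add: summable_real_powr_iff)
  then have "summable (\<lambda>n. real (Suc n) powr (-3/2))" using summable_Suc_iff[of "\<lambda>n. real n powr (-3/2)"] by simp
  then have sm: "summable (\<lambda>n. \<phi> (real n))" by (simp add: \<phi>_def add.commute)
  have "(\<Sum>j\<in>X. \<phi> (real_of_int j)) \<le> 2 * (\<Sum>n. \<phi> (real n))" if "finite X" for X :: "int set"
  proof -
    define P where "P = X \<inter> {0..}"
    define N where "N = X \<inter> {..<0}"
    have half: "(\<Sum>j\<in>Y. \<phi> (real_of_int j)) \<le> (\<Sum>n. \<phi> (real n))" if Y: "finite Y" "inj_on (\<lambda>j. nat \<bar>j\<bar>) Y" for Y :: "int set"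
    proof -
      have "(\<Sum>j\<in>Y. \<phi> (real_of_int j)) = (\<Sum>j\<in>Y. \<phi> (real (nat \<bar>j\<bar>)))"
        by (rule sum.cong) (auto simp: \<phi>_def)
      also have "\<dots> = (\<Sum>n\<in>(\<lambda>j. nat \<bar>j\<bar>) ` Y. \<phi> (real n))"
        by (simp add: sum.reindex[OF Y(2)])
      also have "\<dots> \<le> (\<Sum>n. \<phi> (real n))" using sm Y nn by (intro sum_le_suminf) auto
      finally show ?thesis .
    qed
    have "X = P \<union> N" "P \<inter> N = {}" unfolding P_def N_def by auto
    then have "(\<Sum>j\<in>X. \<phi> (real_of_int j)) = (\<Sum>j\<in>P. \<phi> (real_of_int j)) + (\<Sum>j\<in>N. \<phi> (real_of_int j))"
      using that by (metis finite_Un sum.union_disjoint)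
    also have "\<dots> \<le> (\<Sum>n. \<phi> (real n)) + (\<Sum>n. \<phi> (real n))"
      by (intro add_mono half) (use that in \<open>auto simp: P_def N_def inj_on_def\<close>)
    finally show ?thesis by simp
  qed
  moreover have "2 * (\<Sum>n. \<phi> (real n)) \<ge> 0" using suminf_nonneg[OF sm] nn by simp
  ultimately show ?thesis unfolding \<phi>_def by blast
qed

text \<open>
  The planar kernel \<open>1 / \<bar>\<zeta>\<bar>\<^sup>3\<close> is dominated by a product of two one-dimensional kernels of exponent
  \<open>3/2 > 1\<close>, because both coordinates are \<open>O(\<bar>\<zeta>\<bar>)\<close>. This turns a sum over the square lattice into a
  product of two convergent series.
\<close>
lemma inverse_cube_le_lattice:
  fixes \<zeta> :: complex
  assumes "1 \<le> cmod \<zeta>" and "\<bar>x\<bar> \<le> cmod \<zeta> + 1" "\<bar>y\<bar> \<le> cmod \<zeta> + 1"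
  shows "1 / cmod \<zeta> ^ 3 \<le> 27 * ((1 + \<bar>x\<bar>) powr (-3/2) * (1 + \<bar>y\<bar>) powr (-3/2))"
proof -
  have nz: "\<zeta> \<noteq> 0" using assms(1) by auto
  have cube: "(t * t) powr (3/2) = t ^ 3" if "0 < t" for t :: real
  proof -
    have "t * t = t powr 2" using that by (simp add: power2_eq_square)
    then show ?thesis using that by (simp only: powr_powr) simp
  qed
  have "((1 + \<bar>x\<bar>) * (1 + \<bar>y\<bar>)) powr (3/2) \<le> ((3 * cmod \<zeta>) * (3 * cmod \<zeta>)) powr (3/2)"
    using assms by (intro powr_mono2 mult_mono) auto
  also have "\<dots> = (3 * cmod \<zeta>) ^ 3"
    using nz by (intro cube) simp
  finally have le: "((1 + \<bar>x\<bar>) * (1 + \<bar>y\<bar>)) powr (3/2) \<le> (3 * cmod \<zeta>) ^ 3" .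
  have "0 < (1 + \<bar>x\<bar>) * (1 + \<bar>y\<bar>)" by (intro mult_pos_pos) auto
  then have pos: "0 < ((1 + \<bar>x\<bar>) * (1 + \<bar>y\<bar>)) powr (3/2)"
    by (metis powr_gt_zero less_irrefl)
  from le have "1 / (3 * cmod \<zeta>)^3 \<le> 1 / ((1 + \<bar>x\<bar>) * (1 + \<bar>y\<bar>)) powr (3/2)"
    using pos nz by (intro divide_left_mono mult_pos_pos) auto
  also have "\<dots> = (1 + \<bar>x\<bar>) powr (-3/2) * (1 + \<bar>y\<bar>) powr (-3/2)"
    by (simp add: powr_mult powr_minus_divide)
  finally show ?thesis by (simp add: power_mult_distrib field_simps)
qed

text \<open>
  Rounding both coordinates of \<open>c \<alpha> - w\<close> sorts the points into lattice cells. Each cell has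
  circumradius \<open>1 / sqrt 2 < 1\<close>, so it lies in a unit disc and carries mass at most \<open>B\<close>; the bound
  is then \<open>B\<close> times a convergent lattice sum, whatever \<open>w\<close> is.
\<close>
lemma cubic_potential_bounded:
  fixes a :: "'i \<Rightarrow> real" and c :: "'i \<Rightarrow> complex"
  assumes nonneg: "\<And>\<alpha>. \<alpha> \<in> I \<Longrightarrow> 0 \<le> a \<alpha>"
    and local: "\<And>w T. finite T \<Longrightarrow> T \<subseteq> I \<Longrightarrow> (\<And>\<alpha>. \<alpha> \<in> T \<Longrightarrow> cmod (c \<alpha> - w) < 1) \<Longrightarrow> sum a T \<le> B"
  shows "\<exists>K. \<forall>w T. finite T \<longrightarrow> T \<subseteq> I \<longrightarrow> (\<forall>\<alpha>\<in>T. 1 \<le> cmod (c \<alpha> - w)) \<longrightarrow>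
           (\<Sum>\<alpha>\<in>T. a \<alpha> / cmod (c \<alpha> - w) ^ 3) \<le> K"
proof -
  define \<phi> where "\<phi> j = (1 + \<bar>real_of_int j\<bar>) powr (-3/2)" for j :: int
  obtain K where K: "K \<ge> 0" "\<And>X. finite X \<Longrightarrow> sum \<phi> X \<le> K"
    using bounded_sums_int_powr unfolding \<phi>_def by blast
  have \<phi>: "\<phi> j \<ge> 0" for j by (simp add: \<phi>_def)
  have B: "0 \<le> B" using local[of "{}"] by simp
  have "(\<Sum>\<alpha>\<in>T. a \<alpha> / cmod (c \<alpha> - w) ^ 3) \<le> 27 * B * K\<^sup>2"
    if T: "finite T" "T \<subseteq> I" and far: "\<forall>\<alpha>\<in>T. 1 \<le> cmod (c \<alpha> - w)" for w T
  proof -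
    define q where "q \<alpha> = (round (Re (c \<alpha> - w)), round (Im (c \<alpha> - w)))" for \<alpha>
    define X where "X = fst ` q ` T"
    define Y where "Y = snd ` q ` T"
    have fin: "finite X" "finite Y" using T by (auto simp: X_def Y_def)
    have q_in: "q ` T \<subseteq> X \<times> Y" by (intro image_subsetI) (simp add: X_def Y_def mem_Times_iff)
    have termwise: "a \<alpha> / cmod (c \<alpha> - w) ^ 3 \<le> 27 * a \<alpha> * (\<phi> (fst (q \<alpha>)) * \<phi> (snd (q \<alpha>)))"
      if "\<alpha> \<in> T" for \<alpha>
    proof -
      have "\<bar>real_of_int (round x)\<bar> \<le> \<bar>x\<bar> + 1" for x :: real
        using of_int_round_abs_le[of x] by linarith
      from this[of "Re (c \<alpha> - w)"] this[of "Im (c \<alpha> - w)"]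
      have "1 / cmod (c \<alpha> - w) ^ 3 \<le> 27 * (\<phi> (fst (q \<alpha>)) * \<phi> (snd (q \<alpha>)))"
        unfolding \<phi>_def q_def fst_conv snd_conv using far that
          abs_Re_le_cmod[of "c \<alpha> - w"] abs_Im_le_cmod[of "c \<alpha> - w"]
        by (intro inverse_cube_le_lattice) auto
      then have "a \<alpha> * (1 / cmod (c \<alpha> - w) ^ 3) \<le> a \<alpha> * (27 * (\<phi> (fst (q \<alpha>)) * \<phi> (snd (q \<alpha>))))"
        using that T nonneg by (intro mult_left_mono) auto
      then show ?thesis by (simp add: algebra_simps)
    qed
    have cell: "(\<Sum>\<alpha>\<in>{\<alpha>\<in>T. q \<alpha> = p}. a \<alpha>) \<le> B" for p
    proof (rule local[where w = "w + Complex (fst p) (snd p)"])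
      fix \<alpha> assume "\<alpha> \<in> {\<alpha>\<in>T. q \<alpha> = p}"
      then have p: "p = q \<alpha>" by simp
      define x y where "x = Re (c \<alpha> - w) - round (Re (c \<alpha> - w))"
        and "y = Im (c \<alpha> - w) - round (Im (c \<alpha> - w))"
      have "\<bar>x\<bar> \<le> 1/2" "\<bar>y\<bar> \<le> 1/2"
        unfolding x_def y_def using of_int_round_abs_le by (metis abs_minus_commute)+
      then have "x\<^sup>2 \<le> (1/2)\<^sup>2" "y\<^sup>2 \<le> (1/2)\<^sup>2" by (metis abs_ge_zero power2_abs power_mono)+
      then have "x\<^sup>2 + y\<^sup>2 < 1" by (simp add: power_divide)
      moreover have "c \<alpha> - (w + Complex (fst p) (snd p)) = Complex x y"
        by (simp add: complex_eq_iff p q_def x_def y_def)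
      ultimately show "cmod (c \<alpha> - (w + Complex (fst p) (snd p))) < 1"
        by (simp add: cmod_def)
    qed (use T in auto)
    have "(\<Sum>\<alpha>\<in>T. a \<alpha> / cmod (c \<alpha> - w) ^ 3) \<le> (\<Sum>\<alpha>\<in>T. 27 * a \<alpha> * (\<phi> (fst (q \<alpha>)) * \<phi> (snd (q \<alpha>))))"
      by (rule sum_mono) (rule termwise)
    also have "\<dots> = (\<Sum>p\<in>q ` T. \<Sum>\<alpha>\<in>{\<alpha>\<in>T. q \<alpha> = p}. 27 * a \<alpha> * (\<phi> (fst (q \<alpha>)) * \<phi> (snd (q \<alpha>))))"
      by (rule sum.image_gen[OF T(1)])
    also have "\<dots> = (\<Sum>p\<in>q ` T. 27 * (\<Sum>\<alpha>\<in>{\<alpha>\<in>T. q \<alpha> = p}. a \<alpha>) * (\<phi> (fst p) * \<phi> (snd p)))"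
      by (intro sum.cong refl) (simp add: sum_distrib_left sum_distrib_right)
    also have "\<dots> \<le> (\<Sum>p\<in>q ` T. 27 * B * (\<phi> (fst p) * \<phi> (snd p)))"
      using cell \<phi> by (intro sum_mono mult_right_mono) auto
    also have "\<dots> \<le> (\<Sum>p\<in>X \<times> Y. 27 * B * (\<phi> (fst p) * \<phi> (snd p)))"
      using fin q_in \<phi> B by (intro sum_mono2) auto
    also have "\<dots> = 27 * B * (sum \<phi> X * sum \<phi> Y)"
    proof -
      have "sum \<phi> X * sum \<phi> Y = (\<Sum>p\<in>X \<times> Y. \<phi> (fst p) * \<phi> (snd p))"
        by (simp only: sum_product sum.cartesian_product) (simp add: case_prod_unfold)
      then show ?thesis by (simp add: sum_distrib_left)
    qed
    also have "\<dots> \<le> 27 * B * (K * K)"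
      using fin K B \<phi> by (intro mult_left_mono mult_mono) (auto intro: sum_nonneg)
    finally show ?thesis by (simp add: power2_eq_square)
  qed
  then show ?thesis by blast
qed

section \<open>Zeros of entire functions\<close>

lemma entire_eventually_nonzero:
  assumes "f holomorphic_on UNIV" and "f \<noteq> (\<lambda>_. 0)"
  shows "\<forall>\<^sub>F z in at w. f z \<noteq> 0"
proof -
  obtain b where "f b \<noteq> 0" using assms(2) by blast
  then show ?thesis
    using non_zero_neighbour_alt[OF assms(1), of w b] by (auto elim: eventually_mono)
qed

lemma entire_mult_eq_0:
  assumes "f holomorphic_on UNIV" "g holomorphic_on UNIV" and "\<And>z. f z * g z = 0"
  shows "f = (\<lambda>_. 0) \<or> g = (\<lambda>_. 0)"
proof (rule ccontr)
  assume "\<not> ?thesis"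
  then have "\<forall>\<^sub>F z in at 0. f z \<noteq> 0 \<and> g z \<noteq> 0"
    using assms(1,2) by (intro eventually_conj entire_eventually_nonzero) auto
  then have "\<forall>\<^sub>F z in at (0::complex). False"
    by (rule eventually_mono) (use assms(3) in auto)
  then show False by simp
qed

lemma entire_mult_right_cancel:
  assumes "f holomorphic_on UNIV" "g holomorphic_on UNIV" "p holomorphic_on UNIV"
    and "p \<noteq> (\<lambda>_. 0)" and "\<And>z. f z * p z = g z * p z"
  shows "f = g"
proof -
  have "(\<lambda>z. f z - g z) = (\<lambda>_. 0) \<or> p = (\<lambda>_. 0)"
    using assms by (intro entire_mult_eq_0 holomorphic_intros) (auto simp: algebra_simps)
  then show ?thesis using assms(4) by (auto simp: fun_eq_iff)
qed

lemma analytic_at_entire: "f holomorphic_on UNIV \<Longrightarrow> f analytic_on {w}"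
  using analytic_at open_UNIV by blast

lemma zorder_entire_nonneg:
  assumes "f holomorphic_on UNIV" and "f \<noteq> (\<lambda>_. 0)"
  shows "0 \<le> zorder f w"
  using entire_eventually_nonzero[OF assms, of w]
  by (intro zorder_ge_0 analytic_at_entire assms eventually_frequently) auto

lemma zero_mult_mult:
  assumes "f holomorphic_on UNIV" "g holomorphic_on UNIV"
    and "f \<noteq> (\<lambda>_. 0)" "g \<noteq> (\<lambda>_. 0)"
  shows "zero_mult (\<lambda>z. f z * g z) w = zero_mult f w + zero_mult g w"
proof -
  have "\<forall>\<^sub>F z in at w. f z * g z \<noteq> 0"
    using entire_eventually_nonzero[OF assms(1,3)] entire_eventually_nonzero[OF assms(2,4)]
    by eventually_elim simp
  then have "zorder (\<lambda>z. f z * g z) w = zorder f w + zorder g w"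
    using assms by (intro zorder_times_analytic analytic_at_entire)
  then show ?thesis
    using zorder_entire_nonneg assms by (simp add: zero_mult_def nat_add_distrib)
qed

definition root_prod :: "complex multiset \<Rightarrow> complex \<Rightarrow> complex" where
  "root_prod M z = (\<Prod>a\<in>#M. z - a)"

lemma root_prod_empty [simp]: "root_prod {#} z = 1"
  and root_prod_add [simp]: "root_prod (add_mset a M) z = (z - a) * root_prod M z"
  and root_prod_union: "root_prod (M + N) z = root_prod M z * root_prod N z"
  by (simp_all add: root_prod_def)

lemma root_prod_sum: "root_prod (\<Sum>\<alpha>\<in>S. G \<alpha>) z = (\<Prod>\<alpha>\<in>S. root_prod (G \<alpha>) z)"
  by (induction S rule: infinite_finite_induct) (simp_all add: root_prod_union)

lemma root_prod_eq_0_iff: "root_prod M z = 0 \<longleftrightarrow> z \<in># M"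
  by (induction M) auto

lemma root_prod_holomorphic [holomorphic_intros]: "root_prod M holomorphic_on A"
proof (induction M)
  case empty
  then show ?case by (simp add: root_prod_def)
next
  case (add a M)
  have "root_prod (add_mset a M) = (\<lambda>z. (z - a) * root_prod M z)" by auto
  then show ?case by (auto intro!: holomorphic_intros add)
qed

lemma root_prod_not_zero: "root_prod M \<noteq> (\<lambda>_. 0)"
proof
  assume "root_prod M = (\<lambda>_. 0)"
  then have "set_mset M = UNIV" using root_prod_eq_0_iff[of M] by (auto simp: fun_eq_iff)
  then show False using infinite_UNIV_char_0[where 'a=complex] by (metis finite_set_mset)
qed

lemma zero_mult_linear: "zero_mult (\<lambda>z. z - a) w = (if w = a then 1 else 0)"
proof (cases "w = a")
  case True
  have "zorder (\<lambda>z. z - a) a = 1" by (rule zorder_eqI[where S = UNIV and g = "\<lambda>_. 1"]) auto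
  then show ?thesis using True by (simp add: zero_mult_def)
next
  case False
  then have "zorder (\<lambda>z. z - a) w = 0" by (intro zorder_eq_0I analytic_intros) auto
  then show ?thesis using False by (simp add: zero_mult_def)
qed

lemma linear_not_zero: "(\<lambda>z. z - a :: complex) \<noteq> (\<lambda>_. 0)"
  by (metis add_diff_cancel_left' zero_neq_one)

lemma zero_mult_root_prod: "zero_mult (root_prod M) w = count M w"
proof (induction M)
  case empty
  have "root_prod {#} = (\<lambda>_. 1)" by auto
  then show ?case by (simp add: zero_mult_def)
next
  case (add a M)
  have "root_prod (add_mset a M) = (\<lambda>z. (z - a) * root_prod M z)" by auto
  then have "zero_mult (root_prod (add_mset a M)) w = zero_mult (\<lambda>z. z - a) w + count M w"
    using add by (simp add: zero_mult_mult linear_not_zero root_prod_not_zero holomorphic_intros)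
  then show ?case by (simp add: zero_mult_linear del: root_prod_add)
qed

text \<open>
  This makes the quotient of \<open>f\<close> by finitely many of its zeros an entire function, so that the
  partial exchanges below never have to be handled as meromorphic functions.
\<close>
lemma entire_divide_root_prod:
  assumes "f holomorphic_on UNIV" "f \<noteq> (\<lambda>_. 0)" and "\<And>z. count M z \<le> zero_mult f z"
  shows "\<exists>F. F holomorphic_on UNIV \<and> (\<forall>z. f z = F z * root_prod M z)"
  using assms
proof (induction M arbitrary: f)
  case empty
  then show ?case by auto
next
  case (add a M)
  have "zero_mult f a \<noteq> 0" using add.prems(3)[of a] by simp
  then have "f a = 0"
    using zorder_eq_0I[OF analytic_at_entire[OF add.prems(1)], of a] by (auto simp: zero_mult_def)
  define F where "F z = (if z = a then deriv f a else (f z - f a) / (z - a))" for z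
  have F: "F holomorphic_on UNIV"
    unfolding F_def by (rule pole_lemma) (use add.prems in auto)
  have f: "f = (\<lambda>z. (z - a) * F z)" using \<open>f a = 0\<close> by (auto simp: F_def)
  then have F0: "F \<noteq> (\<lambda>_. 0)" using add.prems(2) by auto
  have "zero_mult f z = (if z = a then 1 else 0) + zero_mult F z" for z
    unfolding f by (subst zero_mult_mult) (auto simp: zero_mult_linear F F0 linear_not_zero intro!: holomorphic_intros)
  then have "count M z \<le> zero_mult F z" for z
    using add.prems(3)[of z] by (auto split: if_splits)
  from add.IH[OF F F0 this] obtain F' where
    "F' holomorphic_on UNIV" "\<forall>z. F z = F' z * root_prod M z" by blast
  then show ?case using f by (intro exI[of _ F']) (auto simp: fun_eq_iff)
qed

lemma sum_count_le_cluster_sum: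
  assumes "finite S" "S \<subseteq> I" and "finite {\<alpha>\<in>I. z \<in># G \<alpha>}"
  shows "count (\<Sum>\<alpha>\<in>S. G \<alpha>) z \<le> cluster_sum I G z"
proof -
  have "count (\<Sum>\<alpha>\<in>S. G \<alpha>) z = (\<Sum>\<alpha>\<in>S. count (G \<alpha>) z)" by (simp add: count_sum)
  also have "\<dots> = (\<Sum>\<alpha>\<in>{\<alpha>\<in>S. z \<in># G \<alpha>}. count (G \<alpha>) z)"
    using assms(1) by (intro sum.mono_neutral_right) (auto simp: not_in_iff)
  also have "\<dots> \<le> cluster_sum I G z"
    unfolding cluster_sum_def using assms by (intro sum_mono2) auto
  finally show ?thesis .
qed

lemma cluster_sum_eq_count:
  assumes "finite S" "S \<subseteq> I" and "\<And>\<alpha>. \<alpha> \<in> I \<Longrightarrow> z \<in># G \<alpha> \<Longrightarrow> \<alpha> \<in> S"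
  shows "cluster_sum I G z = count (\<Sum>\<alpha>\<in>S. G \<alpha>) z"
proof -
  have "count (\<Sum>\<alpha>\<in>S. G \<alpha>) z = (\<Sum>\<alpha>\<in>S. count (G \<alpha>) z)" by (simp add: count_sum)
  also have "\<dots> = cluster_sum I G z"
    unfolding cluster_sum_def
    using assms by (intro sum.mono_neutral_right) (auto simp: not_in_iff)
  finally show ?thesis by simp
qed

section \<open>Logarithms of products of linear factors\<close>

text \<open>
  The third derivative of \<open>Ln (1 - x)\<close> is at most \<open>16\<close> in modulus on the disc of radius \<open>1/2\<close>; the form
  of Taylor's theorem used here then gives the constant \<open>16 / 2!\<close>.
\<close>
lemma Ln_quadratic_remainder:
  fixes \<zeta> :: complex
  assumes "cmod \<zeta> \<le> 1/2"
  shows "cmod (Ln (1 - \<zeta>) + \<zeta> + \<zeta>\<^sup>2 / 2) \<le> 8 * cmod \<zeta> ^ 3"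
proof -
  define f where "f i x = (if i = 0 then Ln (1 - x) else if i = 1 then - (1 / (1 - x))
     else if i = 2 then - (1 / (1 - x)^2) else - (2 / (1 - x)^3))" for i :: nat and x :: complex
  have far: "1/2 \<le> cmod (1 - x)" if "x \<in> cball 0 (1/2)" for x :: complex
    using that norm_triangle_ineq2[of 1 x] by simp
  have nonpos: "1 - x \<notin> \<real>\<^sub>\<le>\<^sub>0" if "x \<in> cball 0 (1/2)" for x :: complex
  proof -
    have "Re x \<le> 1/2" using that complex_Re_le_cmod[of x] by simp
    then show ?thesis by (auto simp: complex_nonpos_Reals_iff)
  qed
  have "cmod (f 0 \<zeta> - (\<Sum>i\<le>2. f i 0 * (\<zeta> - 0) ^ i / fact i)) \<le> 16 * cmod (\<zeta> - 0) ^ Suc 2 / fact 2"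
  proof (rule complex_Taylor[where S = "cball 0 (1/2)"])
    fix i :: nat and x :: complex
    assume x: "x \<in> cball 0 (1/2)" and i: "i \<le> 2"
    have nz: "1 - x \<noteq> 0" using far[OF x] by auto
    consider "i = 0" | "i = 1" | "i = 2" using i by linarith
    then show "(f i has_field_derivative f (Suc i) x) (at x within cball 0 (1/2))"
    proof cases
      case 1
      then show ?thesis using nz nonpos[OF x] unfolding f_def
        by (auto intro!: derivative_eq_intros simp: field_simps)
    next
      case 2
      then show ?thesis using nz unfolding f_def
        by (auto intro!: derivative_eq_intros simp: divide_simps power2_eq_square)
    next
      case 3
      then show ?thesis using nz unfolding f_def
        by (auto intro!: derivative_eq_intros simp: divide_simps power2_eq_square power3_eq_cube power4_eq_xxxx)
    qed
  next
    fix x :: complex assume x: "x \<in> cball 0 (1/2)"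
    have "(1/2)^3 \<le> cmod (1 - x)^3" by (rule power_mono[OF far[OF x]]) simp
    moreover have "0 < cmod (1 - x)" using far[OF x] by linarith
    ultimately show "cmod (f (Suc 2) x) \<le> 16"
      by (simp add: f_def norm_divide norm_power power_divide divide_simps)
  qed (use assms in auto)
  then show ?thesis
    by (simp add: f_def numeral_2_eq_2 power2_eq_square eval_nat_numeral field_simps)
qed

text \<open>
  A logarithm of \<open>root_prod M z / (z - c) ^ size M\<close>. When \<open>z\<close> is farther from \<open>c\<close> than all of \<open>M\<close>, each
  argument of \<open>Ln\<close> has positive real part, so the principal branch is holomorphic there.
\<close>
definition log_root_sum :: "complex \<Rightarrow> complex multiset \<Rightarrow> complex \<Rightarrow> complex" where
  "log_root_sum c M z = (\<Sum>a\<in>#M. Ln (1 - (a - c) / (z - c)))"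

lemma root_prod_eq_exp:
  assumes "\<And>a. a \<in># M \<Longrightarrow> cmod (a - c) < cmod (z - c)"
  shows "root_prod M z = (z - c) ^ size M * exp (log_root_sum c M z)"
  using assms
proof (induction M)
  case empty
  then show ?case by (simp add: log_root_sum_def)
next
  case (add a M)
  have lt: "cmod (a - c) < cmod (z - c)" using add.prems by simp
  then have "z - c \<noteq> 0" by auto
  moreover have "z \<noteq> a" using lt by auto
  ultimately have "z - a = (z - c) * exp (Ln (1 - (a - c) / (z - c)))"
    by (subst exp_Ln) (auto simp: field_simps)
  then show ?case
    using add by (simp add: log_root_sum_def exp_add)
qed

lemma log_root_sum_holomorphic:
  assumes "\<And>a z. a \<in># M \<Longrightarrow> z \<in> A \<Longrightarrow> cmod (a - c) < cmod (z - c)"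
  shows "log_root_sum c M holomorphic_on A"
  using assms
proof (induction M)
  case empty
  then show ?case by (simp add: log_root_sum_def)
next
  case (add a M)
  have "(\<lambda>z. Ln (1 - (a - c) / (z - c))) holomorphic_on A"
  proof (intro holomorphic_intros)
    fix z assume "z \<in> A"
    then have lt: "cmod (a - c) < cmod (z - c)" using add.prems by simp
    then show "z - c \<noteq> 0" by auto
    have "cmod ((a - c) / (z - c)) < 1" using lt by (simp add: norm_divide divide_simps)
    then have "0 < Re (1 - (a - c) / (z - c))"
      using complex_Re_le_cmod[of "(a - c) / (z - c)"] by simp
    then show "1 - (a - c) / (z - c) \<notin> \<real>\<^sub>\<le>\<^sub>0"
      by (auto simp: complex_nonpos_Reals_iff)
  qed
  moreover have "log_root_sum c M holomorphic_on A" by (rule add.IH) (use add.prems in auto)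
  moreover have "log_root_sum c (add_mset a M) =
      (\<lambda>z. Ln (1 - (a - c) / (z - c)) + log_root_sum c M z)"
    by (auto simp: log_root_sum_def)
  ultimately show ?case by (simp add: holomorphic_on_add)
qed

text \<open>
  To second order, \<open>log_root_sum\<close> depends on \<open>M\<close> only through the first two power sums of \<open>M\<close> about \<open>c\<close>.
\<close>
lemma log_root_sum_remainder:
  assumes "\<And>a. a \<in># M \<Longrightarrow> cmod (a - c) \<le> r" and "2 * r \<le> cmod (z - c)" "z \<noteq> c"
  shows "cmod (log_root_sum c M z + (\<Sum>a\<in>#M. a - c) / (z - c) + (\<Sum>a\<in>#M. (a - c)\<^sup>2) / (2 * (z - c)\<^sup>2))
           \<le> 8 * (real (size M) * r ^ 3 / cmod (z - c) ^ 3)"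
  using assms(1)
proof (induction M)
  case empty
  then show ?case by (simp add: log_root_sum_def)
next
  case (add a M)
  have a: "cmod (a - c) \<le> r" using add.prems by simp
  define \<zeta> where "\<zeta> = (a - c) / (z - c)"
  define R where "R = log_root_sum c M z + (\<Sum>a\<in>#M. a - c) / (z - c)
    + (\<Sum>a\<in>#M. (a - c)\<^sup>2) / (2 * (z - c)\<^sup>2)"
  have pos: "0 < cmod (z - c)" using assms(3) by simp
  have "cmod \<zeta> \<le> 1/2" using a assms(2) pos by (simp add: \<zeta>_def norm_divide divide_simps)
  then have "cmod (Ln (1 - \<zeta>) + \<zeta> + \<zeta>\<^sup>2 / 2) \<le> 8 * cmod \<zeta> ^ 3"
    by (rule Ln_quadratic_remainder)
  also have "\<dots> \<le> 8 * (r ^ 3 / cmod (z - c) ^ 3)"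
    using a pos by (simp add: \<zeta>_def norm_divide power_divide divide_right_mono power_mono)
  finally have "cmod (Ln (1 - \<zeta>) + \<zeta> + \<zeta>\<^sup>2 / 2) \<le> 8 * (r ^ 3 / cmod (z - c) ^ 3)" .
  moreover have "cmod R \<le> 8 * (real (size M) * r ^ 3 / cmod (z - c) ^ 3)"
    unfolding R_def using add by simp
  moreover have "log_root_sum c (add_mset a M) z + (\<Sum>a\<in>#add_mset a M. a - c) / (z - c)
    + (\<Sum>a\<in>#add_mset a M. (a - c)\<^sup>2) / (2 * (z - c)\<^sup>2) = (Ln (1 - \<zeta>) + \<zeta> + \<zeta>\<^sup>2 / 2) + R"
    using assms(3) by (simp add: R_def \<zeta>_def log_root_sum_def add_divide_distrib power_divide)
  ultimately show ?case
    using norm_triangle_ineq[of "Ln (1 - \<zeta>) + \<zeta> + \<zeta>\<^sup>2 / 2" R]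
    by (simp add: add_divide_distrib distrib_right algebra_simps)
qed

lemma centred_power_sums:
  fixes c :: complex
  shows "(\<Sum>a\<in>#M. a - c) = (\<Sum>a\<in>#M. a ^ 1) - of_nat (size M) * c"
    and "(\<Sum>a\<in>#M. (a - c)\<^sup>2) = (\<Sum>a\<in>#M. a ^ 2) - 2 * c * (\<Sum>a\<in>#M. a ^ 1) + of_nat (size M) * c\<^sup>2"
  by (induction M) (simp_all add: algebra_simps power2_eq_square)

section \<open>Circle means in the Fock space\<close>

lemma circle_mean_bound:
  assumes "h holomorphic_on UNIV" and "0 < \<rho>"
  shows "ennreal (cmod (h w)) \<le> (\<integral>\<^sup>+t. indicator {0..1} t * ennreal (cmod (h (circlepath w \<rho> t))) \<partial>lborel)"
proof -
  have "((\<lambda>u. h u / (u - w)) has_contour_integral 2 * of_real pi * \<i> * h w) (circlepath w \<rho>)"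
    using assms by (intro Cauchy_integral_circlepath_simple) (auto intro: holomorphic_on_subset)
  moreover have "h (circlepath w \<rho> t) / (circlepath w \<rho> t - w) * vector_derivative (circlepath w \<rho>) (at t)
      = 2 * of_real pi * \<i> * h (circlepath w \<rho> t)" for t
  proof -
    define e where "e = exp (2 * of_real pi * \<i> * of_real t)"
    have "circlepath w \<rho> t - w = of_real \<rho> * e" by (simp add: circlepath e_def)
    moreover have "vector_derivative (circlepath w \<rho>) (at t) = 2 * of_real pi * \<i> * (of_real \<rho> * e)"
      by (simp add: vector_derivative_circlepath e_def)
    moreover have "of_real \<rho> * e \<noteq> 0" using assms(2) by (simp add: e_def)
    ultimately show ?thesis by simp
  qed
  ultimately have "((\<lambda>t. 2 * of_real pi * \<i> * h (circlepath w \<rho> t)) has_integral 2 * of_real pi * \<i> * h w) {0..1}"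
    unfolding has_contour_integral by simp
  then have mean: "((\<lambda>t. h (circlepath w \<rho> t)) has_integral h w) {0..1}"
    by (subst (asm) has_integral_mult_right_iff) auto
  have cont: "continuous_on {0..1} (\<lambda>t. cmod (h (circlepath w \<rho> t)))"
  proof (rule continuous_on_norm, rule continuous_on_compose2[where g = h and t = UNIV])
    show "continuous_on UNIV h" using assms(1) by (rule holomorphic_on_imp_continuous_on)
    show "continuous_on {0..1} (circlepath w \<rho>)"
      unfolding circlepath by (intro continuous_intros)
  qed simp
  then have int: "(\<lambda>t. cmod (h (circlepath w \<rho> t))) integrable_on {0..1}"
    by (rule integrable_continuous_real)
  have "cmod (h w) \<le> integral {0..1} (\<lambda>t. cmod (h (circlepath w \<rho> t)))"
    using integral_norm_bound_integral[OF has_integral_integrable[OF mean] int]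
    by (simp add: integral_unique[OF mean])
  then have "ennreal (cmod (h w)) \<le> ennreal (integral {0..1} (\<lambda>t. cmod (h (circlepath w \<rho> t))))"
    by (rule ennreal_leI)
  also have "\<dots> = (\<integral>\<^sup>+t. ennreal (indicator {0..1} t * cmod (h (circlepath w \<rho> t))) \<partial>lborel)"
    using nn_integral_has_integral_lebesgue[OF _ integrable_integral[OF int]] by simp
  also have "\<dots> = (\<integral>\<^sup>+t. indicator {0..1} t * ennreal (cmod (h (circlepath w \<rho> t))) \<partial>lborel)"
    by (intro nn_integral_cong) (auto simp: indicator_def)
  finally show ?thesis .
qed

definition fock_density :: "(complex \<Rightarrow> complex) \<Rightarrow> complex \<Rightarrow> real" where
  "fock_density f z = (cmod (f z))\<^sup>2 * exp (- (cmod z)\<^sup>2)"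

text \<open>
  The mean value property is applied to \<open>(h z)\<^sup>2 * exp (- 2 * cnj w * (z - w))\<close>. Since
  \<open>\<bar>z\<bar>\<^sup>2 = \<bar>w\<bar>\<^sup>2 + 2 Re (cnj w * (z - w)) + \<bar>z - w\<bar>\<^sup>2\<close>, the exponential converts the weight at the centre
  into the weight on the circle, at the cost of the constant \<open>exp (\<rho>\<^sup>2)\<close>.
\<close>
lemma fock_density_circle_mean:
  assumes "h holomorphic_on UNIV" and "0 < \<rho>"
  shows "ennreal (fock_density h w) \<le>
    (\<integral>\<^sup>+t. indicator {0..1} t * ennreal (exp (\<rho>\<^sup>2) * fock_density h (circlepath w \<rho> t)) \<partial>lborel)"
proof -
  define k where "k z = of_real (exp (- (cmod w)\<^sup>2)) * ((h z)\<^sup>2 * exp (- (2 * cnj w * (z - w))))" for z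
  have k: "k holomorphic_on UNIV"
    unfolding k_def[abs_def] using assms by (intro holomorphic_intros)
  have kw: "cmod (k w) = fock_density h w"
    by (simp add: k_def fock_density_def norm_mult norm_power)
  have "cmod (k z) = exp (\<rho>\<^sup>2) * fock_density h z" if "cmod (z - w) = \<rho>" for z
  proof -
    have "(cmod z)\<^sup>2 = (cmod w)\<^sup>2 + Re (2 * cnj w * (z - w)) + (cmod (z - w))\<^sup>2"
      by (simp only: cmod_power2) (simp add: power2_eq_square algebra_simps)
    then have "- (cmod w)\<^sup>2 - Re (2 * cnj w * (z - w)) = \<rho>\<^sup>2 - (cmod z)\<^sup>2"
      using that by simp
    then have "exp (- (cmod w)\<^sup>2) * exp (- Re (2 * cnj w * (z - w))) = exp (\<rho>\<^sup>2) * exp (- (cmod z)\<^sup>2)"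
      by (metis diff_conv_add_uminus exp_add)
    then show ?thesis
      by (simp add: k_def fock_density_def norm_mult norm_power norm_exp_eq_Re mult_ac del: minus_complex.simps)
  qed
  moreover have "cmod (circlepath w \<rho> t - w) = \<rho>" for t
    using assms(2) by (simp add: circlepath norm_mult norm_exp_eq_Re)
  ultimately show ?thesis
    using circle_mean_bound[OF k assms(2), of w] by (simp add: kw)
qed

text \<open>
  By Tonelli's theorem and translation invariance, averaging over circles of a fixed radius does not
  change the integral over the plane.
\<close>
lemma nn_integral_circle_translates:
  fixes \<phi> :: "complex \<Rightarrow> ennreal"
  assumes [measurable]: "\<phi> \<in> borel_measurable borel"
  shows "(\<integral>\<^sup>+w. (\<integral>\<^sup>+t. indicator {0..1} t * \<phi> (circlepath w \<rho> t) \<partial>lborel) \<partial>lborel) = (\<integral>\<^sup>+z. \<phi> z \<partial>lborel)"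
proof -
  define e where "e t = of_real \<rho> * exp (2 * of_real pi * \<i> * of_real t)" for t :: real
  have [measurable]: "e \<in> borel_measurable borel"
    unfolding e_def by (intro borel_measurable_continuous_onI continuous_intros)
  have translate: "(\<integral>\<^sup>+w. \<phi> (a + w) \<partial>lborel) = (\<integral>\<^sup>+z. \<phi> z \<partial>lborel)" for a
    by (subst (2) lborel_distr_plus[of a, symmetric]) (simp add: nn_integral_distr)
  have "(\<integral>\<^sup>+w. (\<integral>\<^sup>+t. indicator {0..1} t * \<phi> (circlepath w \<rho> t) \<partial>lborel) \<partial>lborel)
      = (\<integral>\<^sup>+w. (\<integral>\<^sup>+t. indicator {0..1} t * \<phi> (e t + w) \<partial>lborel) \<partial>lborel)"
    by (simp add: circlepath e_def add.commute)
  also have "\<dots> = (\<integral>\<^sup>+t. (\<integral>\<^sup>+w. indicator {0..1} t * \<phi> (e t + w) \<partial>lborel) \<partial>lborel)"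
    by (rule lborel_pair.Fubini') measurable
  also have "\<dots> = (\<integral>\<^sup>+t. indicator {0..1::real} t * (\<integral>\<^sup>+z. \<phi> z \<partial>lborel) \<partial>lborel)"
    by (simp add: nn_integral_cmult translate)
  also have "\<dots> = (\<integral>\<^sup>+z. \<phi> z \<partial>lborel)"
    by (simp add: nn_integral_multc)
  finally show ?thesis .
qed

lemma in_fock_iff: "f \<in> fock \<longleftrightarrow> f holomorphic_on UNIV \<and> (\<integral>\<^sup>+z. ennreal (fock_density f z) \<partial>lborel) < \<infinity>"
proof -
  have "ennreal (1 / pi) * X < \<infinity> \<longleftrightarrow> X < \<infinity>" for X :: ennreal
    by (auto simp: ennreal_mult_less_top ennreal_zero_less_divide)
  then show ?thesis unfolding fock_def fock_density_def by simp
qed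

lemma fock_density_measurable:
  assumes "f holomorphic_on UNIV"
  shows "fock_density f \<in> borel_measurable borel"
proof -
  have "continuous_on UNIV f" using assms by (rule holomorphic_on_imp_continuous_on)
  then show ?thesis
    unfolding fock_density_def[abs_def] by (intro borel_measurable_continuous_onI continuous_intros)
qed

section \<open>Exchange of clusters with equal power sums\<close>

text \<open>
  The hypotheses are symmetric in \<open>G\<close> and \<open>G'\<close> (lemma \<open>swapped\<close>), which is why finiteness is required
  of the centres in a disc and not of the points of the clusters. The constant \<open>D\<close> is a common bound
  for the radii and the unit of length: from distance \<open>2 * D\<close> on, a cluster counts as far away.
  The constant \<open>K\<close> bounds the potential of the masses \<open>m \<cdot> r\<^sup>3\<close> uniformly in the plane.
\<close>
locale cluster_exchange =
  fixes I :: "'i set" and G G' :: "'i \<Rightarrow> complex multiset" and c :: "'i \<Rightarrow> complex"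
    and r :: "'i \<Rightarrow> real" and D K :: real
  assumes D: "1 \<le> D"
    and radius: "\<And>\<alpha>. \<alpha> \<in> I \<Longrightarrow> 0 \<le> r \<alpha> \<and> r \<alpha> \<le> D"
    and in_disc: "\<And>\<alpha> a. \<alpha> \<in> I \<Longrightarrow> a \<in># G \<alpha> \<Longrightarrow> cmod (a - c \<alpha>) \<le> r \<alpha>"
    and in_disc': "\<And>\<alpha> a. \<alpha> \<in> I \<Longrightarrow> a \<in># G' \<alpha> \<Longrightarrow> cmod (a - c \<alpha>) \<le> r \<alpha>"
    and size_eq: "\<And>\<alpha>. \<alpha> \<in> I \<Longrightarrow> size (G \<alpha>) = size (G' \<alpha>)"
    and power_sums_eq: "\<And>\<alpha> p. \<alpha> \<in> I \<Longrightarrow> p \<in> {1, 2::nat} \<Longrightarrow> (\<Sum>z\<in>#G \<alpha>. z ^ p) = (\<Sum>z\<in>#G' \<alpha>. z ^ p)"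
    and finite_near: "\<And>w R. finite {\<alpha>\<in>I. cmod (c \<alpha> - w) < R}"
    and potential: "\<And>T w. finite T \<Longrightarrow> T \<subseteq> I \<Longrightarrow> (\<And>\<alpha>. \<alpha> \<in> T \<Longrightarrow> 1 \<le> cmod (c \<alpha> - w)) \<Longrightarrow>
       (\<Sum>\<alpha>\<in>T. real (size (G \<alpha>)) * r \<alpha> ^ 3 / cmod (c \<alpha> - w) ^ 3) \<le> K"
begin

definition log_quot :: "'i \<Rightarrow> complex \<Rightarrow> complex" where
  "log_quot \<alpha> z = log_root_sum (c \<alpha>) (G' \<alpha>) z - log_root_sum (c \<alpha>) (G \<alpha>) z"

lemma far_strict:
  assumes "\<alpha> \<in> I" and "2 * D \<le> cmod (c \<alpha> - z)"
  shows "a \<in># G \<alpha> \<Longrightarrow> cmod (a - c \<alpha>) < cmod (z - c \<alpha>)"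
    and "a \<in># G' \<alpha> \<Longrightarrow> cmod (a - c \<alpha>) < cmod (z - c \<alpha>)"
  using D radius[OF assms(1)] in_disc[OF assms(1), of a] in_disc'[OF assms(1), of a] assms(2)
  by (fastforce simp: norm_minus_commute)+

text \<open>
  Equal sizes and equal power sums of order \<open>1\<close> and \<open>2\<close> give equal power sums about the centre, so
  the terms of order \<open>1\<close> and \<open>2\<close> in \<open>1 / (z - c \<alpha>)\<close> cancel and the cubic remainders are left.
\<close>
lemma log_quot_bound:
  assumes "\<alpha> \<in> I" and "2 * D \<le> cmod (c \<alpha> - z)"
  shows "cmod (log_quot \<alpha> z) \<le> 16 * (real (size (G \<alpha>)) * r \<alpha> ^ 3 / cmod (c \<alpha> - z) ^ 3)"
proof -
  have z: "2 * r \<alpha> \<le> cmod (z - c \<alpha>)" "z \<noteq> c \<alpha>"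
    using assms radius[OF assms(1)] D by (auto simp: norm_minus_commute)
  let ?m = "\<lambda>M. (\<Sum>a\<in>#M. a - c \<alpha>) / (z - c \<alpha>) + (\<Sum>a\<in>#M. (a - c \<alpha>)\<^sup>2) / (2 * (z - c \<alpha>)\<^sup>2)"
  have "?m (G \<alpha>) = ?m (G' \<alpha>)"
    unfolding centred_power_sums using size_eq[OF assms(1)]
      power_sums_eq[OF assms(1), of 1] power_sums_eq[OF assms(1), of 2] by simp
  then have "log_quot \<alpha> z = (log_root_sum (c \<alpha>) (G' \<alpha>) z + ?m (G' \<alpha>)) -
      (log_root_sum (c \<alpha>) (G \<alpha>) z + ?m (G \<alpha>))"
    by (simp add: log_quot_def)
  then have "cmod (log_quot \<alpha> z) \<le> cmod (log_root_sum (c \<alpha>) (G' \<alpha>) z + ?m (G' \<alpha>)) +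
      cmod (log_root_sum (c \<alpha>) (G \<alpha>) z + ?m (G \<alpha>))"
    by (metis norm_triangle_ineq4)
  also have "\<dots> \<le> 8 * (real (size (G' \<alpha>)) * r \<alpha> ^ 3 / cmod (z - c \<alpha>) ^ 3)
      + 8 * (real (size (G \<alpha>)) * r \<alpha> ^ 3 / cmod (z - c \<alpha>) ^ 3)"
    using log_root_sum_remainder[of "G' \<alpha>" "c \<alpha>" "r \<alpha>" z, OF in_disc'[OF assms(1)] z]
      log_root_sum_remainder[of "G \<alpha>" "c \<alpha>" "r \<alpha>" z, OF in_disc[OF assms(1)] z]
    by (intro add_mono) (simp_all add: add.assoc)
  finally show ?thesis using size_eq[OF assms(1)] by (simp add: norm_minus_commute)
qed

lemma root_prod_exchange:
  assumes "\<alpha> \<in> I" and "2 * D \<le> cmod (c \<alpha> - z)"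
  shows "root_prod (G' \<alpha>) z = root_prod (G \<alpha>) z * exp (log_quot \<alpha> z)"
    and "root_prod (G \<alpha>) z \<noteq> 0"
proof -
  have "root_prod (G' \<alpha>) z = (z - c \<alpha>) ^ size (G' \<alpha>) * exp (log_root_sum (c \<alpha>) (G' \<alpha>) z)"
    and G: "root_prod (G \<alpha>) z = (z - c \<alpha>) ^ size (G \<alpha>) * exp (log_root_sum (c \<alpha>) (G \<alpha>) z)"
    using far_strict[OF assms] by (auto intro!: root_prod_eq_exp)
  then show "root_prod (G' \<alpha>) z = root_prod (G \<alpha>) z * exp (log_quot \<alpha> z)"
    using size_eq[OF assms(1)] by (simp add: log_quot_def exp_diff)
  have "z \<noteq> c \<alpha>" using assms(2) D by auto
  then show "root_prod (G \<alpha>) z \<noteq> 0" unfolding G by simp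
qed

lemma root_prod_sum_exchange:
  assumes "finite T" "T \<subseteq> I" and "\<And>\<alpha>. \<alpha> \<in> T \<Longrightarrow> 2 * D \<le> cmod (c \<alpha> - z)"
  shows "root_prod (\<Sum>\<alpha>\<in>T. G' \<alpha>) z = root_prod (\<Sum>\<alpha>\<in>T. G \<alpha>) z * exp (\<Sum>\<alpha>\<in>T. log_quot \<alpha> z)"
    and "root_prod (\<Sum>\<alpha>\<in>T. G \<alpha>) z \<noteq> 0"
proof -
  show "root_prod (\<Sum>\<alpha>\<in>T. G' \<alpha>) z = root_prod (\<Sum>\<alpha>\<in>T. G \<alpha>) z * exp (\<Sum>\<alpha>\<in>T. log_quot \<alpha> z)"
    unfolding root_prod_sum exp_sum[OF assms(1)] prod.distrib[symmetric]
    using assms by (intro prod.cong refl root_prod_exchange) auto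
  show "root_prod (\<Sum>\<alpha>\<in>T. G \<alpha>) z \<noteq> 0"
    unfolding root_prod_sum using assms root_prod_exchange(2) by (auto simp: prod_zero_iff)
qed

lemma sum_log_quot_bound:
  assumes "finite T" "T \<subseteq> I" and "\<And>\<alpha>. \<alpha> \<in> T \<Longrightarrow> 2 * D \<le> cmod (c \<alpha> - z)"
  shows "(\<Sum>\<alpha>\<in>T. cmod (log_quot \<alpha> z)) \<le> 16 * K"
proof -
  have "(\<Sum>\<alpha>\<in>T. cmod (log_quot \<alpha> z))
      \<le> (\<Sum>\<alpha>\<in>T. 16 * (real (size (G \<alpha>)) * r \<alpha> ^ 3 / cmod (c \<alpha> - z) ^ 3))"
    using assms by (intro sum_mono log_quot_bound) auto
  also have "\<dots> \<le> 16 * K"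
    unfolding sum_distrib_left[symmetric] using assms D
    by (intro mult_left_mono potential) force+
  finally show ?thesis .
qed

text \<open>
  The product of \<open>root_prod (G' \<alpha>) z / root_prod (G \<alpha>) z\<close> over the clusters outside \<open>S\<close>, for \<open>z\<close> far from
  all of these clusters. Written as the exponential of a sum, it has no zeros by construction.
\<close>
definition far_factor :: "'i set \<Rightarrow> complex \<Rightarrow> complex" where
  "far_factor S z = exp (\<Sum>\<^sub>\<infinity>\<alpha>\<in>I - S. log_quot \<alpha> z)"

lemma far_factor_nonzero [simp]: "far_factor S z \<noteq> 0"
  by (simp add: far_factor_def)
lemma summable_log_quot:
  assumes "\<And>\<alpha>. \<alpha> \<in> I - S \<Longrightarrow> 2 * D \<le> cmod (c \<alpha> - z)"
  shows "(\<lambda>\<alpha>. cmod (log_quot \<alpha> z)) summable_on (I - S)"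
proof (rule nonneg_bdd_above_summable_on)
  show "bdd_above (sum (\<lambda>\<alpha>. norm (log_quot \<alpha> z)) ` {F. F \<subseteq> I - S \<and> finite F})"
    using assms by (intro bdd_aboveI2[where M = "16 * K"] sum_log_quot_bound) auto
qed simp

lemma far_factor_bound:
  assumes "\<And>\<alpha>. \<alpha> \<in> I - S \<Longrightarrow> 2 * D \<le> cmod (c \<alpha> - z)"
  shows "cmod (far_factor S z) \<le> exp (16 * K)"
proof -
  have "cmod (\<Sum>\<^sub>\<infinity>\<alpha>\<in>I - S. log_quot \<alpha> z) \<le> (\<Sum>\<^sub>\<infinity>\<alpha>\<in>I - S. cmod (log_quot \<alpha> z))"
    by (rule norm_infsum_bound[OF summable_log_quot[OF assms]])
  also have "\<dots> \<le> 16 * K"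
    by (rule infsum_le_finite_sums[OF summable_log_quot[OF assms] sum_log_quot_bound])
      (use assms in auto)
  finally have "cmod (\<Sum>\<^sub>\<infinity>\<alpha>\<in>I - S. log_quot \<alpha> z) \<le> 16 * K" .
  then show ?thesis
    unfolding far_factor_def by (metis exp_le_cancel_iff norm_exp order_trans)
qed

lemma far_factor_insert:
  assumes "finite T" "S \<subseteq> T" "T \<subseteq> I" and "\<And>\<alpha>. \<alpha> \<in> I - S \<Longrightarrow> 2 * D \<le> cmod (c \<alpha> - z)"
  shows "far_factor S z = exp (\<Sum>\<alpha>\<in>T - S. log_quot \<alpha> z) * far_factor T z"
proof -
  have "(\<lambda>\<alpha>. log_quot \<alpha> z) summable_on (T - S)" using assms(1) by simp
  moreover have "(\<lambda>\<alpha>. log_quot \<alpha> z) summable_on (I - T)"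
    using assms by (intro abs_summable_summable[OF summable_log_quot]) auto
  ultimately have "(\<Sum>\<^sub>\<infinity>\<alpha>\<in>(T - S) \<union> (I - T). log_quot \<alpha> z)
      = (\<Sum>\<^sub>\<infinity>\<alpha>\<in>T - S. log_quot \<alpha> z) + (\<Sum>\<^sub>\<infinity>\<alpha>\<in>I - T. log_quot \<alpha> z)"
    by (intro infsum_Un_disjoint) auto
  moreover have "(T - S) \<union> (I - T) = I - S" using assms by auto
  ultimately have "(\<Sum>\<^sub>\<infinity>\<alpha>\<in>I - S. log_quot \<alpha> z)
      = (\<Sum>\<^sub>\<infinity>\<alpha>\<in>T - S. log_quot \<alpha> z) + (\<Sum>\<^sub>\<infinity>\<alpha>\<in>I - T. log_quot \<alpha> z)"
    by simp
  then show ?thesis using assms(1) by (simp add: far_factor_def exp_add)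
qed

lemma log_quot_holomorphic:
  assumes "\<alpha> \<in> I" and "\<And>z. z \<in> A \<Longrightarrow> 2 * D \<le> cmod (c \<alpha> - z)"
  shows "log_quot \<alpha> holomorphic_on A"
proof -
  have "(\<lambda>z. log_root_sum (c \<alpha>) (G' \<alpha>) z - log_root_sum (c \<alpha>) (G \<alpha>) z) holomorphic_on A"
    using far_strict[OF assms] by (intro holomorphic_on_diff log_root_sum_holomorphic) auto
  then show ?thesis by (simp add: log_quot_def[abs_def])
qed

text \<open>
  When \<open>z\<close> moves in the closed unit disc about \<open>w\<close>, the distances to the centres outside \<open>S\<close> stay above
  \<open>2 * D\<close> and change at most by the factor \<open>2\<close>. Hence the terms of the potential at \<open>w\<close>, multiplied by
  \<open>16 * 2 ^ 3 = 128\<close>, are a summable majorant for the logarithms.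
\<close>
lemma far_factor_holomorphic:
  assumes "\<And>\<alpha>. \<alpha> \<in> I - S \<Longrightarrow> 2 * D + 1 \<le> cmod (c \<alpha> - w)"
  shows "far_factor S holomorphic_on ball w 1"
proof -
  have near: "2 * D \<le> cmod (c \<alpha> - z)" "cmod (c \<alpha> - w) \<le> 2 * cmod (c \<alpha> - z)"
    if "\<alpha> \<in> I - S" "z \<in> cball w 1" for \<alpha> z
    using assms[OF that(1)] that(2) norm_triangle_ineq[of "c \<alpha> - z" "z - w"] D
    by (auto simp: dist_norm norm_minus_commute)
  have bound: "cmod (log_quot \<alpha> z) \<le> 128 * (real (size (G \<alpha>)) * r \<alpha> ^ 3 / cmod (c \<alpha> - w) ^ 3)"
    if "\<alpha> \<in> I - S" "z \<in> cball w 1" for \<alpha> z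
  proof -
    have pos: "0 < cmod (c \<alpha> - w)" using assms[OF that(1)] D by linarith
    have pos': "0 < cmod (c \<alpha> - z)" using near[OF that] D by linarith
    have "cmod (c \<alpha> - w) ^ 3 \<le> (2 * cmod (c \<alpha> - z)) ^ 3"
      by (rule power_mono[OF near(2)[OF that]]) simp
    then have "1 / cmod (c \<alpha> - z) ^ 3 \<le> 8 * (1 / cmod (c \<alpha> - w) ^ 3)"
      using pos pos' by (simp add: power_mult_distrib divide_simps)
    then have "(16 * (real (size (G \<alpha>)) * r \<alpha> ^ 3)) * (1 / cmod (c \<alpha> - z) ^ 3)
        \<le> (16 * (real (size (G \<alpha>)) * r \<alpha> ^ 3)) * (8 * (1 / cmod (c \<alpha> - w) ^ 3))"
      using radius that(1) by (intro mult_left_mono) auto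
    then show ?thesis using log_quot_bound[of \<alpha> z] near(1)[OF that] that(1) by simp
  qed
  have summable: "(\<lambda>\<alpha>. 128 * (real (size (G \<alpha>)) * r \<alpha> ^ 3 / cmod (c \<alpha> - w) ^ 3)) summable_on (I - S)"
  proof (intro summable_on_cmult_right nonneg_bdd_above_summable_on)
    show "bdd_above (sum (\<lambda>\<alpha>. real (size (G \<alpha>)) * r \<alpha> ^ 3 / cmod (c \<alpha> - w) ^ 3) ` {F. F \<subseteq> I - S \<and> finite F})"
    proof (rule bdd_aboveI2[where M = K], rule potential)
      fix F \<alpha> assume "F \<in> {F. F \<subseteq> I - S \<and> finite F}" "\<alpha> \<in> F"
      then show "1 \<le> cmod (c \<alpha> - w)" using assms[of \<alpha>] D by auto
    qed auto
  qed (use radius in auto)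
  have "(\<lambda>z. \<Sum>\<^sub>\<infinity>\<alpha>\<in>I - S. log_quot \<alpha> z) holomorphic_on ball w 1"
  proof (rule holomorphic_uniform_limit)
    show "uniform_limit (cball w 1) (\<lambda>F z. \<Sum>\<alpha>\<in>F. log_quot \<alpha> z) (\<lambda>z. \<Sum>\<^sub>\<infinity>\<alpha>\<in>I - S. log_quot \<alpha> z)
        (finite_subsets_at_top (I - S))"
      by (rule Weierstrass_m_test_general[OF bound summable])
    have "(\<lambda>z. \<Sum>\<alpha>\<in>F. log_quot \<alpha> z) holomorphic_on cball w 1" if "F \<subseteq> I - S" for F
      using that near(1) by (intro holomorphic_on_sum log_quot_holomorphic) auto
    then show "\<forall>\<^sub>F F in finite_subsets_at_top (I - S).
        continuous_on (cball w 1) (\<lambda>z. \<Sum>\<alpha>\<in>F. log_quot \<alpha> z) \<and>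
        (\<lambda>z. \<Sum>\<alpha>\<in>F. log_quot \<alpha> z) holomorphic_on ball w 1"
      by (intro eventually_finite_subsets_at_top_weakI)
        (meson ball_subset_cball holomorphic_on_imp_continuous_on holomorphic_on_subset)
  qed auto
  then show ?thesis
    unfolding far_factor_def[abs_def] by (intro holomorphic_intros)
qed

lemma finite_members: "finite {\<alpha>\<in>I. z \<in># G \<alpha>}"
proof (rule finite_subset[OF _ finite_near[of z "D + 1"]])
  show "{\<alpha>\<in>I. z \<in># G \<alpha>} \<subseteq> {\<alpha>\<in>I. cmod (c \<alpha> - z) < D + 1}"
    using in_disc radius by (fastforce simp: norm_minus_commute)
qed

lemma swapped: "cluster_exchange I G' G c r D K"
proof
  fix T w assume T: "finite T" "T \<subseteq> I" and far: "\<And>\<alpha>. \<alpha> \<in> T \<Longrightarrow> 1 \<le> cmod (c \<alpha> - w)"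
  have "(\<Sum>\<alpha>\<in>T. real (size (G' \<alpha>)) * r \<alpha> ^ 3 / cmod (c \<alpha> - w) ^ 3)
      = (\<Sum>\<alpha>\<in>T. real (size (G \<alpha>)) * r \<alpha> ^ 3 / cmod (c \<alpha> - w) ^ 3)"
    using T size_eq by (intro sum.cong) auto
  then show "(\<Sum>\<alpha>\<in>T. real (size (G' \<alpha>)) * r \<alpha> ^ 3 / cmod (c \<alpha> - w) ^ 3) \<le> K"
    using potential[OF T far] by simp
qed (use D radius in_disc in_disc' size_eq power_sums_eq finite_near in auto)

definition near :: "real \<Rightarrow> complex \<Rightarrow> 'i set" where
  "near R w = {\<alpha>\<in>I. cmod (c \<alpha> - w) < R}"

lemma near_finite [simp]: "finite (near R w)"
  and near_subset: "near R w \<subseteq> I"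
  using finite_near by (auto simp: near_def)

lemma finite_exchange:
  assumes "f holomorphic_on UNIV" "f \<noteq> (\<lambda>_. 0)" and "\<And>z. cluster_sum I G z \<le> zero_mult f z"
    and "finite S" "S \<subseteq> I"
  shows "\<exists>h. h holomorphic_on UNIV \<and>
    (\<forall>z. h z * root_prod (\<Sum>\<alpha>\<in>S. G \<alpha>) z = f z * root_prod (\<Sum>\<alpha>\<in>S. G' \<alpha>) z)"
proof -
  have "count (\<Sum>\<alpha>\<in>S. G \<alpha>) z \<le> zero_mult f z" for z
    using sum_count_le_cluster_sum[OF assms(4,5) finite_members] assms(3) by (rule order_trans)
  from entire_divide_root_prod[OF assms(1,2) this] obtain F where
    "F holomorphic_on UNIV" "\<And>z. f z = F z * root_prod (\<Sum>\<alpha>\<in>S. G \<alpha>) z" by blast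
  then show ?thesis
    by (intro exI[of _ "\<lambda>z. F z * root_prod (\<Sum>\<alpha>\<in>S. G' \<alpha>) z"]) (auto intro!: holomorphic_intros)
qed

text \<open>
  Two partial exchanges of \<open>f\<close> agree with each other as far as they can: at a point far from the
  additional clusters, exchanging these as well multiplies the function by the exponential of their
  \<open>log_quot\<close>. The identity is one between entire functions multiplied by the polynomial of the
  clusters in \<open>S\<close>, which may be cancelled even at its zeros.
\<close>
lemma finite_exchange_extend:
  assumes "h holomorphic_on UNIV" "k holomorphic_on UNIV"
    and h: "\<And>z. h z * root_prod (\<Sum>\<alpha>\<in>S. G \<alpha>) z = f z * root_prod (\<Sum>\<alpha>\<in>S. G' \<alpha>) z"
    and k: "\<And>z. k z * root_prod (\<Sum>\<alpha>\<in>T. G \<alpha>) z = f z * root_prod (\<Sum>\<alpha>\<in>T. G' \<alpha>) z"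
    and T: "finite T" "S \<subseteq> T" "T \<subseteq> I" and far: "\<And>\<alpha>. \<alpha> \<in> T - S \<Longrightarrow> 2 * D \<le> cmod (c \<alpha> - z)"
  shows "k z = h z * exp (\<Sum>\<alpha>\<in>T - S. log_quot \<alpha> z)"
proof -
  let ?P = "\<lambda>S z. root_prod (\<Sum>\<alpha>\<in>S. G \<alpha>) z"
  let ?P' = "\<lambda>S z. root_prod (\<Sum>\<alpha>\<in>S. G' \<alpha>) z"
  have split: "?P T z = ?P (T - S) z * ?P S z" "?P' T z = ?P' (T - S) z * ?P' S z" for z
    using sum.subset_diff[OF T(2,1), of G] sum.subset_diff[OF T(2,1), of G']
    by (simp_all add: root_prod_union)
  \<comment> \<open>Both sides times \<open>?P S\<close> equal \<open>f * ?P' T\<close>.\<close>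
  have "(\<lambda>z. k z * ?P (T - S) z) = (\<lambda>z. h z * ?P' (T - S) z)"
  proof (rule entire_mult_right_cancel[OF _ _ root_prod_holomorphic root_prod_not_zero])
    show "k z * ?P (T - S) z * ?P S z = h z * ?P' (T - S) z * ?P S z" for z
      using h[of z] k[of z] unfolding split by (metis mult.assoc mult.commute)
  qed (use assms(1,2) in \<open>auto intro!: holomorphic_intros\<close>)
  then have "k z * ?P (T - S) z = h z * ?P' (T - S) z" by meson
  moreover have sub: "T - S \<subseteq> I" using T by auto
  ultimately show ?thesis
    using root_prod_sum_exchange[OF _ sub far] T(1) by auto
qed

text \<open>
  The function \<open>g\<close> is \<open>f\<close> times the product of all quotients \<open>root_prod (G' \<alpha>) / root_prod (G \<alpha>)\<close>. At each
  point the clusters within distance \<open>2 * D\<close> are exchanged inside the entire function \<open>f\<close>, the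
  others contribute the zero-free \<open>far_factor\<close>. For the norm, let \<open>h\<close> be the function in which only
  the clusters near \<open>w\<close> are exchanged. On the circle of radius \<open>4 * D\<close> about \<open>w\<close> all these clusters are
  at distance at least \<open>2 * D\<close>, so there \<open>h\<close> is bounded by a constant times \<open>f\<close>, however many points the
  clusters have, and the mean value property carries this bound to \<open>w\<close>.
\<close>
theorem exchange_zeros:
  assumes "f \<in> fock" and f0: "f \<noteq> (\<lambda>_. 0)" and van: "\<And>z. cluster_sum I G z \<le> zero_mult f z"
  shows "\<exists>g\<in>fock. g \<noteq> (\<lambda>_. 0) \<and>
    (\<forall>z. zero_mult g z + cluster_sum I G z = zero_mult f z + cluster_sum I G' z)"
proof -
  have f: "f holomorphic_on UNIV" "(\<integral>\<^sup>+z. ennreal (fock_density f z) \<partial>lborel) < \<infinity>"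
    using assms(1) by (auto simp: in_fock_iff)
  define F where "F S = (SOME h. h holomorphic_on UNIV \<and>
    (\<forall>z. h z * root_prod (\<Sum>\<alpha>\<in>S. G \<alpha>) z = f z * root_prod (\<Sum>\<alpha>\<in>S. G' \<alpha>) z))" for S
  have F: "F S holomorphic_on UNIV"
    and F_eq: "F S z * root_prod (\<Sum>\<alpha>\<in>S. G \<alpha>) z = f z * root_prod (\<Sum>\<alpha>\<in>S. G' \<alpha>) z"
    if "finite S" "S \<subseteq> I" for S z
    using someI_ex[OF finite_exchange[OF f(1) f0 van that]] unfolding F_def by blast+
  define g where "g z = F (near (2 * D) z) z * far_factor (near (2 * D) z) z" for z
  \<comment> \<open>Any larger finite set of exchanged clusters gives the same value, so that locally one fixed set can be used.\<close>
  have g_eq: "g z = F T z * far_factor T z"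
    if T: "finite T" "near (2 * D) z \<subseteq> T" "T \<subseteq> I" for z T
  proof -
    let ?S = "near (2 * D) z"
    have far: "2 * D \<le> cmod (c \<alpha> - z)" if "\<alpha> \<in> I - ?S" for \<alpha> using that by (auto simp: near_def)
    have "F T z = F ?S z * exp (\<Sum>\<alpha>\<in>T - ?S. log_quot \<alpha> z)"
      by (rule finite_exchange_extend[OF F F F_eq F_eq]) (use T near_subset far in auto)
    then show ?thesis
      unfolding g_def using far_factor_insert[OF T far] by simp
  qed
  \<comment> \<open>The margin \<open>1\<close> makes \<open>N w\<close> contain all clusters within \<open>2 * D\<close> of any point of \<open>ball w 1\<close>.\<close>
  define N where "N w = near (2 * D + 1) w" for w
  have N: "finite (N w)" "N w \<subseteq> I" for w by (auto simp: N_def near_subset)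
  have N_far: "2 * D + 1 \<le> cmod (c \<alpha> - w)" if "\<alpha> \<in> I - N w" for \<alpha> w
    using that by (auto simp: N_def near_def)
  have g_ball: "g z = F (N w) z * far_factor (N w) z" if "z \<in> ball w 1" for z w
  proof (rule g_eq[OF N(1) _ N(2)])
    have "cmod (z - w) < 1" using that by (simp add: dist_norm norm_minus_commute)
    then have "cmod (c \<alpha> - w) < cmod (c \<alpha> - z) + 1" for \<alpha>
      using norm_triangle_ineq[of "c \<alpha> - z" "z - w"] by simp
    then have "cmod (c \<alpha> - w) < 2 * D + 1" if "cmod (c \<alpha> - z) < 2 * D" for \<alpha>
      using that by (smt (verit))
    then show "near (2 * D) z \<subseteq> N w" by (auto simp: near_def N_def)
  qed
  have far_hol: "far_factor (N w) holomorphic_on ball w 1" for w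
    using N_far by (rule far_factor_holomorphic)
  have "g holomorphic_on ball w 1" for w
  proof -
    have "(\<lambda>z. F (N w) z * far_factor (N w) z) holomorphic_on ball w 1"
      by (rule holomorphic_on_mult[OF holomorphic_on_subset[OF F[OF N]] far_hol]) simp
    then show ?thesis by (rule holomorphic_transform) (rule g_ball[symmetric])
  qed
  then have "g holomorphic_on (\<Union>w. ball w 1)"
    by (intro holomorphic_on_UN_open) auto
  moreover have "(\<Union>w. ball w 1) = (UNIV :: complex set)" by auto
  ultimately have g: "g holomorphic_on UNIV" by simp
  have FN0: "F (N w) \<noteq> (\<lambda>_. 0)" for w
  proof
    assume "F (N w) = (\<lambda>_. 0)"
    then have "f z * root_prod (\<Sum>\<alpha>\<in>N w. G' \<alpha>) z = 0" for z using F_eq[OF N, of w z] by simp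
    then show False using entire_mult_eq_0[OF f(1) root_prod_holomorphic] f0 root_prod_not_zero by blast
  qed
  have zeros: "zero_mult g w + cluster_sum I G w = zero_mult f w + cluster_sum I G' w" for w
  proof -
    have ev: "\<forall>\<^sub>F z in at w. g z = F (N w) z * far_factor (N w) z"
      using g_ball[of _ w] eventually_at_ball[of 1 w UNIV] by (auto elim!: eventually_mono)
    have an: "far_factor (N w) analytic_on {w}"
      using far_hol[of w] unfolding analytic_at by (intro exI[of _ "ball w 1"]) simp
    have "\<forall>\<^sub>F z in at w. F (N w) z * far_factor (N w) z \<noteq> 0"
      using entire_eventually_nonzero[OF F[OF N] FN0] by simp
    from zorder_times_analytic[OF analytic_at_entire[OF F[OF N]] an this]
    have "zorder (\<lambda>z. F (N w) z * far_factor (N w) z) w = zorder (F (N w)) w"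
      using zorder_eq_0I[OF an] by simp
    then have "zero_mult g w = zero_mult (F (N w)) w"
      using zorder_cong[OF ev refl] by (simp add: zero_mult_def)
    moreover have "zero_mult (F (N w)) w + count (\<Sum>\<alpha>\<in>N w. G \<alpha>) w
        = zero_mult f w + count (\<Sum>\<alpha>\<in>N w. G' \<alpha>) w"
    proof -
      have eq: "(\<lambda>z. F (N w) z * root_prod (\<Sum>\<alpha>\<in>N w. G \<alpha>) z) = (\<lambda>z. f z * root_prod (\<Sum>\<alpha>\<in>N w. G' \<alpha>) z)"
        using F_eq[OF N] by blast
      have "zero_mult (F (N w)) w + count (\<Sum>\<alpha>\<in>N w. G \<alpha>) w
          = zero_mult (\<lambda>z. F (N w) z * root_prod (\<Sum>\<alpha>\<in>N w. G \<alpha>) z) w"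
        by (simp only: zero_mult_mult[OF F[OF N] root_prod_holomorphic FN0 root_prod_not_zero] zero_mult_root_prod)
      also have "\<dots> = zero_mult f w + count (\<Sum>\<alpha>\<in>N w. G' \<alpha>) w"
        by (simp only: eq zero_mult_mult[OF f(1) root_prod_holomorphic f0 root_prod_not_zero] zero_mult_root_prod)
      finally show ?thesis .
    qed
    moreover have "\<alpha> \<in> N w" if "\<alpha> \<in> I" "cmod (w - c \<alpha>) \<le> r \<alpha>" for \<alpha>
      using that radius[OF that(1)] D by (simp add: N_def near_def norm_minus_commute)
    then have "cluster_sum I G w = count (\<Sum>\<alpha>\<in>N w. G \<alpha>) w"
      "cluster_sum I G' w = count (\<Sum>\<alpha>\<in>N w. G' \<alpha>) w"
      using N in_disc in_disc' by (auto intro!: cluster_sum_eq_count)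
    ultimately show ?thesis by simp
  qed
  have g0: "g \<noteq> (\<lambda>_. 0)"
  proof
    assume "g = (\<lambda>_. 0)"
    then have "F (N 0) z = 0" if "z \<in> ball 0 1" for z
      using g_ball[OF that] by simp
    then have "\<forall>\<^sub>F z in at 0. F (N 0) z = 0"
      using eventually_at_ball[of 1 0 UNIV] by (auto elim!: eventually_mono)
    with entire_eventually_nonzero[OF F[OF N] FN0] have "\<forall>\<^sub>F z in at (0::complex). False"
      by eventually_elim auto
    then show False by simp
  qed
  \<comment> \<open>A factor \<open>exp (16 * K)\<close> each for the near and for the far clusters, squared, and \<open>exp (\<rho>\<^sup>2)\<close> with \<open>\<rho> = 4 * D\<close>.\<close>
  define C where "C = exp ((4 * D)\<^sup>2) * exp (64 * K)"
  have growth: "ennreal (fock_density g w) \<le>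
      (\<integral>\<^sup>+t. indicator {0..1} t * ennreal (C * fock_density f (circlepath w (4 * D) t)) \<partial>lborel)" for w
  proof -
    let ?S = "near (2 * D) w"
    have S: "finite ?S" "?S \<subseteq> I" by (simp_all add: near_subset)
    \<comment> \<open>The far factor is evaluated at the centre \<open>w\<close>, hence a constant; thus \<open>h\<close> is entire and \<open>h w = g w\<close>.\<close>
    define h where "h z = F ?S z * far_factor ?S w" for z
    have h: "h holomorphic_on UNIV"
      unfolding h_def[abs_def] using F[OF S] by (intro holomorphic_intros)
    have far: "cmod (far_factor ?S w) \<le> exp (16 * K)"
      by (rule far_factor_bound) (auto simp: near_def)
    have h_le: "fock_density h z \<le> exp (64 * K) * fock_density f z" if z: "cmod (z - w) = 4 * D" for z
    proof -
      have zS: "2 * D \<le> cmod (c \<alpha> - z)" if "\<alpha> \<in> ?S" for \<alpha>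
        using that z norm_triangle_ineq[of "z - c \<alpha>" "c \<alpha> - w"]
        by (simp add: near_def norm_minus_commute)
      have "F ?S z = f z * exp (\<Sum>\<alpha>\<in>?S. log_quot \<alpha> z)"
        using F_eq[OF S, of z] root_prod_sum_exchange[OF S zS] by simp
      moreover have "cmod (exp (\<Sum>\<alpha>\<in>?S. log_quot \<alpha> z)) \<le> exp (16 * K)"
      proof -
        have "cmod (\<Sum>\<alpha>\<in>?S. log_quot \<alpha> z) \<le> 16 * K"
          using norm_sum sum_log_quot_bound[OF S zS] by (rule order_trans)
        then show ?thesis by (meson exp_le_cancel_iff norm_exp order_trans)
      qed
      ultimately have "cmod (F ?S z) \<le> cmod (f z) * exp (16 * K)"
        by (metis mult_left_mono norm_ge_zero norm_mult)
      then have "cmod (h z) \<le> cmod (f z) * exp (16 * K) * exp (16 * K)"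
        unfolding h_def norm_mult using far by (intro mult_mono) auto
      then have "(cmod (h z))\<^sup>2 \<le> (cmod (f z) * exp (16 * K) * exp (16 * K))\<^sup>2"
        by (rule power_mono) simp
      also have "\<dots> = (cmod (f z))\<^sup>2 * exp (64 * K)"
        by (simp add: power_mult_distrib mult.assoc flip: exp_add exp_double)
      finally show ?thesis
        unfolding fock_density_def by (simp add: mult_right_mono mult_ac)
    qed
    have "fock_density g w = fock_density h w" by (simp add: fock_density_def g_def h_def)
    also have "ennreal (fock_density h w) \<le>
      (\<integral>\<^sup>+t. indicator {0..1} t * ennreal (exp ((4 * D)\<^sup>2) * fock_density h (circlepath w (4 * D) t)) \<partial>lborel)"
      using D by (intro fock_density_circle_mean h) simp
    also have "\<dots> \<le> (\<integral>\<^sup>+t. indicator {0..1} t * ennreal (C * fock_density f (circlepath w (4 * D) t)) \<partial>lborel)"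
    proof (intro nn_integral_mono mult_left_mono ennreal_leI)
      fix t
      have "cmod (circlepath w (4 * D) t - w) = 4 * D"
        using D by (simp add: circlepath norm_mult norm_exp_eq_Re)
      from h_le[OF this]
      show "exp ((4 * D)\<^sup>2) * fock_density h (circlepath w (4 * D) t)
          \<le> C * fock_density f (circlepath w (4 * D) t)"
        by (simp add: C_def mult.assoc)
    qed simp
    finally show ?thesis .
  qed
  have [measurable]: "fock_density f \<in> borel_measurable borel"
    by (rule fock_density_measurable[OF f(1)])
  have "(\<integral>\<^sup>+w. ennreal (fock_density g w) \<partial>lborel) \<le>
      (\<integral>\<^sup>+w. (\<integral>\<^sup>+t. indicator {0..1} t * ennreal (C * fock_density f (circlepath w (4 * D) t)) \<partial>lborel) \<partial>lborel)"
    by (intro nn_integral_mono growth)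
  also have "\<dots> = (\<integral>\<^sup>+z. ennreal (C * fock_density f z) \<partial>lborel)"
    by (rule nn_integral_circle_translates) measurable
  also have "\<dots> = (\<integral>\<^sup>+z. ennreal C * ennreal (fock_density f z) \<partial>lborel)"
    by (intro nn_integral_cong ennreal_mult') (simp add: C_def)
  also have "\<dots> = ennreal C * (\<integral>\<^sup>+z. ennreal (fock_density f z) \<partial>lborel)"
    by (rule nn_integral_cmult) measurable
  also have "\<dots> < \<infinity>" using f(2) by (simp add: ennreal_mult_less_top)
  finally have "g \<in> fock" using g by (simp add: in_fock_iff)
  then show ?thesis using g0 zeros by blast
qed

corollary fock_zero_set_exchange:
  assumes "fock_zero_set (cluster_sum I G)"
  shows "fock_zero_set (cluster_sum I G')"
proof -
  obtain f where f: "f \<in> fock" "f \<noteq> (\<lambda>_. 0)" "\<And>z. zero_mult f z = cluster_sum I G z"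
    using assms by (auto simp: fock_zero_set_def)
  obtain g where "g \<in> fock" "g \<noteq> (\<lambda>_. 0)"
    "\<And>z. zero_mult g z + cluster_sum I G z = zero_mult f z + cluster_sum I G' z"
    using exchange_zeros[OF f(1,2)] f(3) by auto
  then show ?thesis using f(3) by (auto simp: fock_zero_set_def)
qed

corollary fock_uniqueness_mult_exchange:
  assumes "fock_uniqueness_mult (cluster_sum I G')"
  shows "fock_uniqueness_mult (cluster_sum I G)"
proof (rule ccontr)
  assume "\<not> ?thesis"
  then obtain f where f: "f \<in> fock" "f \<noteq> (\<lambda>_. 0)" and van: "\<And>z. cluster_sum I G z \<le> zero_mult f z"
    by (auto simp: fock_uniqueness_mult_def vanishes_on_def)
  obtain g where g: "g \<in> fock" "g \<noteq> (\<lambda>_. 0)"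
    "\<And>z. zero_mult g z + cluster_sum I G z = zero_mult f z + cluster_sum I G' z"
    using exchange_zeros[OF f van] by blast
  have "cluster_sum I G' z \<le> zero_mult g z" for z using g(3)[of z] van[of z] by linarith
  then show False using assms g(1,2) by (auto simp: fock_uniqueness_mult_def vanishes_on_def)
qed

end

text \<open>
  Each cluster with centre near \<open>w\<close> contains a point, which lies in a fixed compact disc; there the
  points are finitely many, and each belongs to finitely many clusters.
\<close>
lemma finite_clusters_near:
  assumes "locally_finite_mult (cluster_sum I G)"
    and "\<And>\<alpha>. \<alpha> \<in> I \<Longrightarrow> G \<alpha> \<noteq> {#}" and fin: "\<And>z. finite {\<alpha>\<in>I. z \<in># G \<alpha>}"
    and "\<And>\<alpha> a. \<alpha> \<in> I \<Longrightarrow> a \<in># G \<alpha> \<Longrightarrow> cmod (a - c \<alpha>) \<le> D"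
  shows "finite {\<alpha>\<in>I. cmod (c \<alpha> - w) < R}"
proof -
  define Z where "Z = {z \<in> cball w (R + D). cluster_sum I G z \<noteq> 0}"
  have "finite Z" unfolding Z_def
    by (rule assms(1)[unfolded locally_finite_mult_def, rule_format, OF compact_cball])
  have "{\<alpha>\<in>I. cmod (c \<alpha> - w) < R} \<subseteq> (\<Union>z\<in>Z. {\<alpha>\<in>I. z \<in># G \<alpha>})"
  proof
    fix \<alpha> assume "\<alpha> \<in> {\<alpha>\<in>I. cmod (c \<alpha> - w) < R}"
    then have \<alpha>: "\<alpha> \<in> I" "cmod (c \<alpha> - w) < R" by auto
    obtain a where a: "a \<in># G \<alpha>" using assms(2)[OF \<alpha>(1)] by blast
    have "cmod (a - w) \<le> R + D"
      using assms(4)[OF \<alpha>(1) a] \<alpha>(2) norm_triangle_ineq[of "a - c \<alpha>" "c \<alpha> - w"] by simp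
    moreover have "cluster_sum I G a \<noteq> 0"
      unfolding cluster_sum_def using fin[of a] \<alpha>(1) a by (auto simp: not_in_iff)
    ultimately have "a \<in> Z" by (simp add: Z_def dist_norm norm_minus_commute)
    then show "\<alpha> \<in> (\<Union>z\<in>Z. {\<alpha>\<in>I. z \<in># G \<alpha>})" using \<alpha>(1) a by blast
  qed
  then show ?thesis using \<open>finite Z\<close> fin by (auto intro: finite_subset)
qed

theorem theorem7p5:
  fixes \<Lambda> \<Lambda>' :: "complex \<Rightarrow> nat"
    and I :: "'i set"
    and \<Gamma> \<Gamma>' :: "'i \<Rightarrow> complex multiset"
    and c :: "'i \<Rightarrow> complex"
    and r :: "'i \<Rightarrow> real"
    and H :: real
  assumes "locally_finite_mult \<Lambda>"
    and "is_partition \<Lambda> I \<Gamma>"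
    and "\<And>\<alpha>. \<alpha> \<in> I \<Longrightarrow> 0 \<le> r \<alpha> \<and> r \<alpha> \<le> H"
    and "\<And>\<alpha>. \<alpha> \<in> I \<Longrightarrow> set_mset (\<Gamma> \<alpha>) \<union> set_mset (\<Gamma>' \<alpha>) \<subseteq> {z. cmod (z - c \<alpha>) \<le> r \<alpha>}"
    and "\<And>\<alpha>. \<alpha> \<in> I \<Longrightarrow> size (\<Gamma> \<alpha>) = size (\<Gamma>' \<alpha>)"
    and "\<And>\<alpha> p. \<alpha> \<in> I \<Longrightarrow> p \<in> {1, 2::nat} \<Longrightarrow>
           (\<Sum>z\<in>#\<Gamma> \<alpha>. z ^ p) = (\<Sum>z\<in>#\<Gamma>' \<alpha>. z ^ p)"
    and "(SUP w::complex. \<Sum>\<^sub>\<infinity>\<alpha>\<in>{\<alpha>\<in>I. cmod (c \<alpha> - w) < 1}.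
            ennreal (real (size (\<Gamma> \<alpha>)) * r \<alpha> ^ 3)) < \<infinity>"
    and "\<Lambda>' = cluster_sum I \<Gamma>'"
  shows "(fock_zero_set \<Lambda> \<longleftrightarrow> fock_zero_set \<Lambda>') \<and>
         (fock_uniqueness_mult \<Lambda> \<longleftrightarrow> fock_uniqueness_mult \<Lambda>')"
proof -
  \<comment> \<open>The length \<open>D\<close> has to be positive to keep far points off the centres; \<open>H\<close> may be \<open>0\<close>.\<close>
  define D where "D = max H 1"
  define a where "a \<alpha> = real (size (\<Gamma> \<alpha>)) * r \<alpha> ^ 3" for \<alpha>
  have \<Lambda>: "\<Lambda> = cluster_sum I \<Gamma>" and nonempty: "\<And>\<alpha>. \<alpha> \<in> I \<Longrightarrow> \<Gamma> \<alpha> \<noteq> {#}"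
    and fin: "\<And>z. finite {\<alpha>\<in>I. z \<in># \<Gamma> \<alpha>}"
    using assms(2) by (auto simp: is_partition_def)
  have radius: "0 \<le> r \<alpha> \<and> r \<alpha> \<le> D" if "\<alpha> \<in> I" for \<alpha> using assms(3)[OF that] by (auto simp: D_def le_max_iff_disj)
  have a_nonneg: "0 \<le> a \<alpha>" if "\<alpha> \<in> I" for \<alpha> using radius[OF that] by (simp add: a_def)
  define B where "B = enn2real (SUP w::complex. \<Sum>\<^sub>\<infinity>\<alpha>\<in>{\<alpha>\<in>I. cmod (c \<alpha> - w) < 1}. ennreal (a \<alpha>))"
  have "sum a T \<le> B"
    if T: "finite T" "T \<subseteq> I" "\<And>\<alpha>. \<alpha> \<in> T \<Longrightarrow> cmod (c \<alpha> - w) < 1" for w T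
  proof -
    have "ennreal (sum a T) = (\<Sum>\<^sub>\<infinity>\<alpha>\<in>T. ennreal (a \<alpha>))"
      using T a_nonneg by (subst sum_ennreal[symmetric]) auto
    also have "\<dots> \<le> (\<Sum>\<^sub>\<infinity>\<alpha>\<in>{\<alpha>\<in>I. cmod (c \<alpha> - w) < 1}. ennreal (a \<alpha>))"
      using T by (intro infsum_mono_neutral nonneg_summable_on_complete) auto
    also have "\<dots> \<le> (SUP w::complex. \<Sum>\<^sub>\<infinity>\<alpha>\<in>{\<alpha>\<in>I. cmod (c \<alpha> - w) < 1}. ennreal (a \<alpha>))"
      by (rule SUP_upper) simp
    also have "\<dots> = ennreal B" unfolding B_def using assms(7) by (simp add: a_def)
    finally show ?thesis by (simp add: B_def)
  qed
  with a_nonneg obtain K where K: "\<forall>w T. finite T \<longrightarrow> T \<subseteq> I \<longrightarrow> (\<forall>\<alpha>\<in>T. 1 \<le> cmod (c \<alpha> - w)) \<longrightarrow>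
           (\<Sum>\<alpha>\<in>T. a \<alpha> / cmod (c \<alpha> - w) ^ 3) \<le> K"
    using cubic_potential_bounded[of I a c B] by blast
  have in_disc: "cmod (x - c \<alpha>) \<le> r \<alpha>" if "\<alpha> \<in> I" "x \<in># \<Gamma> \<alpha> \<or> x \<in># \<Gamma>' \<alpha>" for \<alpha> x
    using assms(4)[OF that(1)] that(2) by blast
  interpret forward: cluster_exchange I \<Gamma> \<Gamma>' c r D K
  proof
    show "finite {\<alpha>\<in>I. cmod (c \<alpha> - w) < R}" for w R
    proof (rule finite_clusters_near[OF _ nonempty fin])
      show "locally_finite_mult (cluster_sum I \<Gamma>)" using assms(1) by (simp add: \<Lambda>)
      show "cmod (x - c \<alpha>) \<le> D" if "\<alpha> \<in> I" "x \<in># \<Gamma> \<alpha>" for \<alpha> x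
        using in_disc[OF that(1)] radius[OF that(1)] that(2) by force
    qed
    show "(\<Sum>\<alpha>\<in>T. real (size (\<Gamma> \<alpha>)) * r \<alpha> ^ 3 / cmod (c \<alpha> - w) ^ 3) \<le> K"
      if "finite T" "T \<subseteq> I" "\<And>\<alpha>. \<alpha> \<in> T \<Longrightarrow> 1 \<le> cmod (c \<alpha> - w)" for T w
      using K that unfolding a_def by blast
  qed (use radius in_disc assms(5,6) in \<open>auto simp: D_def\<close>)
  \<comment> \<open>Both equivalences follow from exchanging \<open>\<Gamma>\<close> for \<open>\<Gamma>'\<close> and back.\<close>
  interpret backward: cluster_exchange I \<Gamma>' \<Gamma> c r D K by (rule forward.swapped)
  show ?thesis
    unfolding \<Lambda> assms(8)
    using forward.fock_zero_set_exchange backward.fock_zero_set_exchange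
      forward.fock_uniqueness_mult_exchange backward.fock_uniqueness_mult_exchange by blast
qed

end
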